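(* Let $\mathcal E:=\mathbb C\setminus\{(-\infty,-1]\cup[1,+\infty)\}$, let $\mathfrak M,\mathcal K$ be Hilbert spaces and let $$\tau=\{T;\mathfrak M,\mathfrak M,\mathcal K\},\qquad T=\begin{bmatrix}D&C\\ C^*&F\end{bmatrix}:\mathfrak M\oplus\mathcal K\to\mathfrak M\oplus\mathcal K,\quad D=D^*,\ F=F^*,$$ be a passive selfadjoint system. If $\tau$ is conservative, then its transfer function $\Omega(z)=D+zC(I_{\mathcal K}-zF)^{-1}C^*$ is bi-inner and takes the form $$\Omega(z)=(zI_{\mathfrak M}+D)(I_{\mathfrak M}+zD)^{-1},\qquad z\in\mathcal E .$$ On the other hand, if $\tau$ is a minimal passive selfadjoint system whose transfer function is inner, then $\tau$ is conservative.
   Context: Hilbert spaces are complex and separable. A passive selfadjoint system $\tau=\{T;\mathfrak M,\mathfrak M,\mathcal K\}$ is given by a selfadjoint contraction $T=\begin{bmatrix}D&C\\C^*&F\end{bmatrix}$ in $\mathfrak M\oplus\mathcal K$; its transfer function is $\Omega(z)=D+zC(I-zF)^{-1}C^*$, $z\in\mathcal E$. The system is conservative if $T$ is unitary, and minimal if $\overline{\mathrm{span}}\{F^nC^*\mathfrak M:\ n\in\mathbb N_0\}=\mathcal K$. The transfer function is inner (co-inner) if $\Omega(\xi)$ is isometric (co-isometric) for almost every $\xi$ in the unit circle $\mathbb T$, and bi-inner if it is both inner and co-inner (note $\mathbb T\setminus\{\pm1\}\subset\mathcal E$). *)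

theory Defs
  imports "HOL-Analysis.Analysis"
begin

section \<open>Complex Hilbert spaces\<close>

text \<open>The norm of \<open>real_inner\<close> is \<open>sqrt (inner x x) = sqrt (Re (cinner x x))\<close>, so it is the
  norm of the complex inner product. \<open>cinner\<close> is linear in its first argument.\<close>

class complex_inner = real_inner +
  fixes scaleC :: "complex \<Rightarrow> 'a \<Rightarrow> 'a" (infixr "*\<^sub>C" 75)
    and cinner :: "'a \<Rightarrow> 'a \<Rightarrow> complex"
  assumes scaleC_add_right: "a *\<^sub>C (x + y) = a *\<^sub>C x + a *\<^sub>C y"
    and scaleC_add_left: "(a + b) *\<^sub>C x = a *\<^sub>C x + b *\<^sub>C x"
    and scaleC_scaleC: "a *\<^sub>C (b *\<^sub>C x) = (a * b) *\<^sub>C x"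
    and scaleR_scaleC: "scaleR r x = complex_of_real r *\<^sub>C x"
    and cinner_commute: "cinner x y = cnj (cinner y x)"
    and cinner_add_left: "cinner (x + y) z = cinner x z + cinner y z"
    and cinner_scaleC_left: "cinner (a *\<^sub>C x) y = a * cinner x y"
    and inner_eq_Re_cinner: "inner x y = Re (cinner x y)"

class chilbert_space = complex_inner + complete_space

text \<open>The product type carries the inner product of the orthogonal direct sum.\<close>

instantiation prod :: (complex_inner, complex_inner) complex_inner
begin

definition "scaleC a p = (a *\<^sub>C fst p, a *\<^sub>C snd p)"
definition "cinner p q = cinner (fst p) (fst q) + cinner (snd p) (snd q)"

instance
proof
  fix p q :: "'a \<times> 'b"
  show "cinner p q = cnj (cinner q p)"
    unfolding cinner_prod_def complex_cnj_add
    using cinner_commute by metis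
qed (auto simp: scaleC_prod_def cinner_prod_def scaleC_add_right scaleC_add_left scaleC_scaleC
      scaleR_scaleC cinner_add_left cinner_scaleC_left inner_prod_def inner_eq_Re_cinner
      prod_eq_iff algebra_simps)

end

instance prod :: (chilbert_space, chilbert_space) chilbert_space ..

instantiation complex :: chilbert_space
begin

definition "scaleC a (x::complex) = a * x"
definition "cinner x (y::complex) = x * cnj y"

instance
  by standard (auto simp: scaleC_complex_def cinner_complex_def scaleR_conv_of_real
      inner_complex_def algebra_simps)

end

lemma vector_space_scaleC: "vector_space (scaleC :: complex \<Rightarrow> 'a \<Rightarrow> 'a::complex_inner)"
proof
  show "1 *\<^sub>C x = x" for x :: 'a
    using scaleR_scaleC[of 1 x] by simp
qed (simp_all add: scaleC_add_right scaleC_add_left scaleC_scaleC)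

section \<open>Operators\<close>

definition bounded_clinear :: "('a::complex_inner \<Rightarrow> 'b::complex_inner) \<Rightarrow> bool" where
  "bounded_clinear A \<longleftrightarrow> bounded_linear A \<and> (\<forall>c x. A (c *\<^sub>C x) = c *\<^sub>C A x)"

text \<open>Complex counterpart of \<^const>\<open>adjoint\<close>; it is uniquely determined whenever it exists.\<close>

definition cadjoint :: "('a::complex_inner \<Rightarrow> 'b::complex_inner) \<Rightarrow> 'b \<Rightarrow> 'a" where
  "cadjoint A = (SOME B. \<forall>x y. cinner (A x) y = cinner x (B y))"

lemma cadjoint_unique:
  fixes A :: "'a::complex_inner \<Rightarrow> 'b::complex_inner"
  assumes "\<And>x y. cinner (A x) y = cinner x (B y)"
  shows "cadjoint A = B"
proof -
  have "\<forall>x y. cinner (A x) y = cinner x (cadjoint A y)"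
    unfolding cadjoint_def by (rule someI[of _ B]) (use assms in blast)
  then have *: "cinner x (cadjoint A y) = cinner x (B y)" for x y
    using assms by simp
  show ?thesis
  proof
    fix y
    have "inner x (cadjoint A y) = inner x (B y)" for x
      by (simp add: inner_eq_Re_cinner *)
    then show "cadjoint A y = B y"
      using vector_eq_ldot by blast
  qed
qed

definition selfadjoint :: "('a::complex_inner \<Rightarrow> 'a) \<Rightarrow> bool" where
  "selfadjoint A \<longleftrightarrow> bounded_clinear A \<and> (\<forall>x y. cinner (A x) y = cinner x (A y))"

definition contraction :: "('a::complex_inner \<Rightarrow> 'b::complex_inner) \<Rightarrow> bool" where
  "contraction A \<longleftrightarrow> (\<forall>x. norm (A x) \<le> norm x)"

definition isometric :: "('a::complex_inner \<Rightarrow> 'b::complex_inner) \<Rightarrow> bool" where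
  "isometric A \<longleftrightarrow> (\<forall>x. norm (A x) = norm x)"

definition co_isometric :: "('a::complex_inner \<Rightarrow> 'b::complex_inner) \<Rightarrow> bool" where
  "co_isometric A \<longleftrightarrow> isometric (cadjoint A)"

definition unitary :: "('a::complex_inner \<Rightarrow> 'b::complex_inner) \<Rightarrow> bool" where
  "unitary U \<longleftrightarrow> bounded_clinear U \<and> cadjoint U \<circ> U = id \<and> U \<circ> cadjoint U = id"

section \<open>Passive selfadjoint systems\<close>

definition system_operator ::
  "('m::complex_inner \<Rightarrow> 'm) \<Rightarrow> ('k::complex_inner \<Rightarrow> 'm) \<Rightarrow> ('k \<Rightarrow> 'k) \<Rightarrow> 'm \<times> 'k \<Rightarrow> 'm \<times> 'k" where
  "system_operator D C F = (\<lambda>(x, k). (D x + C k, cadjoint C x + F k))"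

definition passive_selfadjoint_system ::
  "('m::chilbert_space \<Rightarrow> 'm) \<Rightarrow> ('k::chilbert_space \<Rightarrow> 'm) \<Rightarrow> ('k \<Rightarrow> 'k) \<Rightarrow> bool" where
  "passive_selfadjoint_system D C F \<longleftrightarrow>
     bounded_clinear C \<and> selfadjoint D \<and> selfadjoint F \<and>
     selfadjoint (system_operator D C F) \<and> contraction (system_operator D C F)"

definition conservative ::
  "('m::chilbert_space \<Rightarrow> 'm) \<Rightarrow> ('k::chilbert_space \<Rightarrow> 'm) \<Rightarrow> ('k \<Rightarrow> 'k) \<Rightarrow> bool" where
  "conservative D C F \<longleftrightarrow> unitary (system_operator D C F)"

definition minimal_system :: "('k::chilbert_space \<Rightarrow> 'm::chilbert_space) \<Rightarrow> ('k \<Rightarrow> 'k) \<Rightarrow> bool" where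
  "minimal_system C F \<longleftrightarrow>
     closure (module.span scaleC (\<Union>n. range (\<lambda>x. (F ^^ n) (cadjoint C x)))) = UNIV"

definition slit_plane :: "complex set" where
  "slit_plane = UNIV - complex_of_real ` ({..-1} \<union> {1..})"

text \<open>For \<open>z\<close> in the slit plane the inverses below are those of bijections;
  see \<open>bij_resolvent_minus\<close> and \<open>bij_resolvent_plus\<close>.\<close>

definition transfer ::
  "('m::chilbert_space \<Rightarrow> 'm) \<Rightarrow> ('k::chilbert_space \<Rightarrow> 'm) \<Rightarrow> ('k \<Rightarrow> 'k) \<Rightarrow> complex \<Rightarrow> 'm \<Rightarrow> 'm" where
  "transfer D C F z = (\<lambda>x. D x + z *\<^sub>C C (inv (\<lambda>k. k - z *\<^sub>C F k) (cadjoint C x)))"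

text \<open>Almost every point of the unit circle: almost every angle with respect to Lebesgue measure.
  The points \<open>1\<close> and \<open>-1\<close>, outside the slit plane, correspond to finitely many angles.\<close>

definition inner_function :: "(complex \<Rightarrow> 'm::chilbert_space \<Rightarrow> 'm) \<Rightarrow> bool" where
  "inner_function \<Omega> \<longleftrightarrow> (AE t in lebesgue_on {0..2*pi}. isometric (\<Omega> (cis t)))"

definition co_inner_function :: "(complex \<Rightarrow> 'm::chilbert_space \<Rightarrow> 'm) \<Rightarrow> bool" where
  "co_inner_function \<Omega> \<longleftrightarrow> (AE t in lebesgue_on {0..2*pi}. co_isometric (\<Omega> (cis t)))"

definition bi_inner_function :: "(complex \<Rightarrow> 'm::chilbert_space \<Rightarrow> 'm) \<Rightarrow> bool" where
  "bi_inner_function \<Omega> \<longleftrightarrow> inner_function \<Omega> \<and> co_inner_function \<Omega>"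

section \<open>Existence of the resolvents\<close>

lemma norm_scaleC: "norm (a *\<^sub>C x) = cmod a * norm (x::'a::complex_inner)"
proof -
  have r: "cinner x (a *\<^sub>C y) = cnj a * cinner x y" for x y :: 'a and a
    using cinner_commute[of x "a *\<^sub>C y"] cinner_commute[of x y] by (simp add: cinner_scaleC_left)
  have "Im (cinner x x) = 0"
    using arg_cong[OF cinner_commute[of x x], of Im] by simp
  moreover have "inner (a *\<^sub>C x) (a *\<^sub>C x) = Re ((a * cnj a) * cinner x x)"
    unfolding inner_eq_Re_cinner r cinner_scaleC_left by (metis mult.assoc mult.commute)
  moreover have "a * cnj a = complex_of_real ((cmod a)\<^sup>2)"
    using complex_norm_square[of a] by simp
  ultimately have "inner (a *\<^sub>C x) (a *\<^sub>C x) = (cmod a)\<^sup>2 * inner x x"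
    by (simp add: inner_eq_Re_cinner)
  then show ?thesis
    by (simp add: norm_eq_sqrt_inner real_sqrt_mult)
qed

lemma slit_plane_rotation:
  assumes "z \<in> slit_plane"
  obtains c where "\<bar>Re (c * z)\<bar> < Re c"
proof (cases "Im z = 0")
  case True
  then have "z = complex_of_real (Re z)" by (simp add: complex_eq_iff)
  with assms have "\<not> Re z \<le> -1" "\<not> Re z \<ge> 1"
    unfolding slit_plane_def by auto
  then show ?thesis by (intro that[of 1]) auto
next
  case False
  then show ?thesis
    by (intro that[of "Complex ((Im z)\<^sup>2) (Re z * Im z)"]) (auto simp: mult.commute power2_eq_square
        zero_less_mult_iff)
qed

lemma bij_resolvent_minus:
  fixes F :: "'a::chilbert_space \<Rightarrow> 'a"
  assumes F: "selfadjoint F" "contraction F" and z: "z \<in> slit_plane"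
  shows "bij (\<lambda>x. x - z *\<^sub>C F x)"
proof -
  interpret vs: vector_space "scaleC :: complex \<Rightarrow> 'a \<Rightarrow> 'a"
    by (rule vector_space_scaleC)
  interpret F: bounded_linear F
    using F unfolding selfadjoint_def bounded_clinear_def by blast
  obtain c where c: "\<bar>Re (c * z)\<bar> < Re c"
    using slit_plane_rotation[OF z] .
  define \<delta> where "\<delta> = Re c - \<bar>Re (c * z)\<bar>"
  define M where "M = cmod c * (1 + cmod z)"
  define t where "t = \<delta> / M\<^sup>2"
  define q where "q = 1 - \<delta>\<^sup>2 / M\<^sup>2"
  have "\<delta> > 0" using c by (simp add: \<delta>_def)
  have "c \<noteq> 0" using c by auto
  then have "M > 0" unfolding M_def by (simp add: add_pos_nonneg)
  define A where "A x = c *\<^sub>C (x - z *\<^sub>C F x)" for x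
  have A_diff: "A x - A y = A (x - y)" for x y
    by (simp add: A_def F.diff vs.scale_right_diff_distrib)
  have lower: "\<delta> * (norm x)\<^sup>2 \<le> inner x (A x)" for x
  proof -
    have "cinner (F x) x = cinner x (F x)"
      using F unfolding selfadjoint_def by blast
    then have im: "Im (cinner (F x) x) = 0"
      using arg_cong[OF cinner_commute[of "F x" x], of Im] by simp
    have imx: "Im (cinner x x) = 0"
      using arg_cong[OF cinner_commute[of x x], of Im] by simp
    have "A x + (c * z) *\<^sub>C F x = c *\<^sub>C x"
      by (simp add: A_def vs.scale_right_diff_distrib)
    then have "cinner (A x) x + (c * z) * cinner (F x) x = c * cinner x x"
      using cinner_add_left[of "A x" "(c * z) *\<^sub>C F x" x] by (simp add: cinner_scaleC_left)
    then have "Re (cinner (A x) x) + Re ((c * z) * cinner (F x) x) = Re (c * cinner x x)"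
      by (metis plus_complex.sel(1))
    then have "inner (A x) x = Re c * inner x x - Re (c * z) * inner (F x) x"
      using im imx by (simp add: inner_eq_Re_cinner)
    moreover have "\<bar>inner (F x) x\<bar> \<le> norm x * norm x"
      using Cauchy_Schwarz_ineq2[of "F x" x] F(2)
      by (meson contraction_def mult_right_mono norm_ge_zero order_trans)
    then have "\<bar>Re (c * z) * inner (F x) x\<bar> \<le> \<bar>Re (c * z)\<bar> * (norm x)\<^sup>2"
      by (simp add: abs_mult power2_eq_square mult_left_mono)
    ultimately show ?thesis
      by (simp add: \<delta>_def inner_commute dot_square_norm left_diff_distrib)
  qed
  have upper: "norm (A x) \<le> M * norm x" for x
  proof -
    have "norm (x - z *\<^sub>C F x) \<le> norm x + cmod z * norm (F x)"
      using norm_triangle_ineq4[of x "z *\<^sub>C F x"] by (simp add: norm_scaleC)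
    also have "\<dots> \<le> norm x + cmod z * norm x"
      using F(2) by (simp add: contraction_def mult_left_mono)
    finally have "cmod c * norm (x - z *\<^sub>C F x) \<le> cmod c * (norm x + cmod z * norm x)"
      by (simp add: mult_left_mono)
    then show ?thesis by (simp add: A_def M_def norm_scaleC distrib_left distrib_right mult.assoc)
  qed
  have "t > 0" using \<open>\<delta> > 0\<close> \<open>M > 0\<close> by (simp add: t_def)
  have contr: "(norm (x - t *\<^sub>R A x))\<^sup>2 \<le> q * (norm x)\<^sup>2" for x
  proof -
    have "(norm (x - t *\<^sub>R A x))\<^sup>2 = (norm x)\<^sup>2 - 2 * t * inner x (A x) + t\<^sup>2 * (norm (A x))\<^sup>2"
      unfolding power2_norm_eq_inner
      by (simp add: inner_diff_left inner_diff_right inner_commute power2_eq_square algebra_simps)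
    also have "\<dots> \<le> (norm x)\<^sup>2 - 2 * t * (\<delta> * (norm x)\<^sup>2) + t\<^sup>2 * (M * norm x)\<^sup>2"
      using lower[of x] upper[of x] \<open>t > 0\<close>
      by (intro add_mono diff_mono mult_left_mono power_mono) auto
    also have "\<dots> = q * (norm x)\<^sup>2"
      using \<open>M > 0\<close> by (simp add: t_def q_def field_simps power2_eq_square)
    finally show ?thesis .
  qed
  define r where "r = sqrt (max q 0)"
  have "q < 1" using \<open>\<delta> > 0\<close> \<open>M > 0\<close> by (simp add: q_def)
  then have r: "0 \<le> r" "r < 1" by (auto simp: r_def)
  have contr': "norm (x - t *\<^sub>R A x) \<le> r * norm x" for x
  proof (rule power2_le_imp_le)
    have "q * (norm x)\<^sup>2 \<le> max q 0 * (norm x)\<^sup>2"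
      by (intro mult_right_mono) auto
    then show "(norm (x - t *\<^sub>R A x))\<^sup>2 \<le> (r * norm x)\<^sup>2"
      using contr[of x] by (simp add: r_def power_mult_distrib)
  qed (use r in simp)
  have "\<exists>!x. x - z *\<^sub>C F x = y" for y
  proof -
    have "\<exists>!x. x - t *\<^sub>R A x + t *\<^sub>R (c *\<^sub>C y) = x"
    proof (rule banach_fix_type[OF r], intro allI)
      fix u v
      have "(u - t *\<^sub>R A u + t *\<^sub>R (c *\<^sub>C y)) - (v - t *\<^sub>R A v + t *\<^sub>R (c *\<^sub>C y))
          = (u - v) - t *\<^sub>R A (u - v)"
        by (simp add: A_diff[symmetric] scaleR_diff_right)
      then show "dist (u - t *\<^sub>R A u + t *\<^sub>R (c *\<^sub>C y)) (v - t *\<^sub>R A v + t *\<^sub>R (c *\<^sub>C y))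
          \<le> r * dist u v"
        using contr'[of "u - v"] unfolding dist_norm by metis
    qed
    moreover have "x - t *\<^sub>R A x + t *\<^sub>R (c *\<^sub>C y) = x \<longleftrightarrow> x - z *\<^sub>C F x = y" for x
    proof -
      have "x - t *\<^sub>R A x + t *\<^sub>R (c *\<^sub>C y) = x \<longleftrightarrow> t *\<^sub>R (c *\<^sub>C y) = t *\<^sub>R A x"
        by (metis add_diff_cancel_left' diff_add_cancel diff_add_eq)
      also have "\<dots> \<longleftrightarrow> x - z *\<^sub>C F x = y"
        using \<open>t > 0\<close> \<open>c \<noteq> 0\<close> by (auto simp: A_def)
      finally show ?thesis .
    qed
    ultimately show ?thesis by simp
  qed
  then show ?thesis
    by (simp add: bij_iff)
qed

lemma bij_resolvent_plus:
  fixes F :: "'a::chilbert_space \<Rightarrow> 'a"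
  assumes "selfadjoint F" "contraction F" "z \<in> slit_plane"
  shows "bij (\<lambda>x. x + z *\<^sub>C F x)"
proof -
  interpret vs: vector_space "scaleC :: complex \<Rightarrow> 'a \<Rightarrow> 'a"
    by (rule vector_space_scaleC)
  have "- z \<in> slit_plane"
  proof (rule ccontr)
    assume "- z \<notin> slit_plane"
    then obtain r where r: "- z = complex_of_real r" "r \<le> -1 \<or> r \<ge> 1"
      unfolding slit_plane_def by auto
    then have "z = complex_of_real (- r)" by (metis add.inverse_inverse of_real_minus)
    with r have "z \<notin> slit_plane" unfolding slit_plane_def by force
    with assms show False by simp
  qed
  from bij_resolvent_minus[OF assms(1,2) this] show ?thesis by simp
qed

lemma passive_selfadjoint_system_contractions:
  assumes "passive_selfadjoint_system D C F"
  shows "contraction D" "contraction F"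
proof -
  have T: "norm (system_operator D C F p) \<le> norm p" for p
    using assms unfolding passive_selfadjoint_system_def contraction_def by blast
  have "C 0 = 0" "D 0 = 0" "F 0 = 0"
    using assms unfolding passive_selfadjoint_system_def selfadjoint_def bounded_clinear_def
    by (auto dest: bounded_linear.linear linear_0)
  then have Dx: "system_operator D C F (x, 0) = (D x, cadjoint C x)" for x
    by (simp add: system_operator_def)
  have "norm (D x) \<le> norm x" for x
    using T[of "(x, 0)"] norm_fst_le[of "D x" "cadjoint C x"]
    unfolding Dx norm_Pair[of x] by simp
  then show "contraction D" by (simp add: contraction_def)
  have "cadjoint C 0 = 0"
  proof -
    have "norm (cadjoint C 0) \<le> norm (system_operator D C F (0, 0))"
      using norm_snd_le[of "cadjoint C 0" "D 0 + C 0"]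
      by (simp add: system_operator_def \<open>F 0 = 0\<close>)
    then show ?thesis using T[of "(0, 0)"] by (simp add: norm_Pair)
  qed
  then have Fk: "system_operator D C F (0, k) = (C k, F k)" for k
    by (simp add: system_operator_def \<open>D 0 = 0\<close>)
  have "norm (F k) \<le> norm k" for k
    using T[of "(0, k)"] norm_snd_le[of "F k" "C k"]
    unfolding Fk norm_Pair[of 0] by simp
  then show "contraction F" by (simp add: contraction_def)
qed

end

theory Submission
  imports Defs
begin

text \<open>If \<open>T\<close> is unitary then \<open>T\<^sup>2 = I\<close>, so \<open>F C\<^sup>* = - C\<^sup>* D\<close> and \<open>C C\<^sup>* = I - D\<^sup>2\<close>; the first
  identity gives \<open>(I - z F)\<^sup>-\<^sup>1 C\<^sup>* = C\<^sup>* (I + z D)\<^sup>-\<^sup>1\<close> and the second one then the formula for the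
  transfer function, from which \<open>\<Omega>(z)\<^sup>* = \<Omega>(cnj z)\<close> and the isometry on the circle are read off.

  Conversely, put \<open>w = (I - z F)\<^sup>-\<^sup>1 C\<^sup>* x\<close>, so that \<open>T (x, z w) = (\<Omega>(z) x, w)\<close>. If \<open>\<bar>z\<bar> = 1\<close> and
  \<open>\<Omega>(z)\<close> is isometric, \<open>T\<close> preserves the norm of \<open>(x, z w)\<close>, hence \<open>T\<^sup>2\<close> fixes this vector and
  the range of \<open>I - T\<^sup>2\<close> is orthogonal to it. Take \<open>(p, q)\<close> in that range; as \<open>T (p, q)\<close> lies there
  too, the choice \<open>x = p\<close> leads to \<open>Im z (\<bar>p\<bar>\<^sup>2 + \<bar>w\<bar>\<^sup>2) = 0\<close>. Thus a single nonreal
  \<open>z\<close> suffices to force \<open>p = 0\<close>. The range of \<open>I - T\<^sup>2\<close> is then a \<open>T\<close>-invariant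
  subspace of \<open>0 \<oplus> \<K>\<close>, and such a subspace is orthogonal to all \<open>F\<^sup>n C\<^sup>* x\<close>,
  so minimality gives \<open>T\<^sup>2 = I\<close>.\<close>

section \<open>Complex inner products and selfadjoint operators\<close>

lemma cinner_add_right: "cinner x (y + z) = cinner x y + cinner x z"
  for x :: "'a::complex_inner"
  by (metis cinner_add_left cinner_commute complex_cnj_add)

lemma cinner_scaleC_right: "cinner x (a *\<^sub>C y) = cnj a * cinner x y"
  for x :: "'a::complex_inner"
  by (metis cinner_scaleC_left cinner_commute complex_cnj_mult)

lemma cinner_diff_left: "cinner (x - y) z = cinner x z - cinner y z"
  for x :: "'a::complex_inner"
  by (metis add_diff_cancel_right' cinner_add_left diff_add_cancel)

lemma cinner_diff_right: "cinner x (y - z) = cinner x y - cinner x z"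
  for x :: "'a::complex_inner"
  by (metis add_diff_cancel_right' cinner_add_right diff_add_cancel)

lemma cinner_zero_left [simp]: "cinner 0 x = 0" for x :: "'a::complex_inner"
  using cinner_diff_left[of x x x] by simp

lemma cinner_zero_right [simp]: "cinner x 0 = 0" for x :: "'a::complex_inner"
  using cinner_diff_right[of x x x] by simp

lemma scaleC_zero_right [simp]: "a *\<^sub>C 0 = (0 :: 'a::complex_inner)"
  using scaleC_add_right[of a 0 "0 :: 'a"] by simp

lemma cinner_self: "cinner x x = complex_of_real ((norm x)\<^sup>2)" for x :: "'a::complex_inner"
proof (rule complex_eqI)
  show "Re (cinner x x) = Re (complex_of_real ((norm x)\<^sup>2))"
    by (simp add: power2_norm_eq_inner flip: inner_eq_Re_cinner)
  show "Im (cinner x x) = Im (complex_of_real ((norm x)\<^sup>2))"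
    using arg_cong[OF cinner_commute[of x x], of Im] by simp
qed

lemma selfadjoint_cinner: "selfadjoint A \<Longrightarrow> cinner (A x) y = cinner x (A y)"
  by (simp add: selfadjoint_def)

lemma selfadjoint_quadratic_form_real:
  assumes "selfadjoint A"
  shows "Im (cinner x (A x)) = 0"
  using arg_cong[OF cinner_commute[of x "A x"], of Im] selfadjoint_cinner[OF assms, of x x] by simp

lemma selfadjoint_cadjoint: "selfadjoint A \<Longrightarrow> cadjoint A = A"
  by (rule cadjoint_unique) (rule selfadjoint_cinner)

lemma selfadjoint_unitary_iff:
  assumes "selfadjoint A"
  shows "unitary A \<longleftrightarrow> (\<forall>x. A (A x) = x)"
  using assms by (auto simp: unitary_def selfadjoint_cadjoint selfadjoint_def fun_eq_iff)

lemma selfadjoint_linear: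
  assumes "selfadjoint A"
  shows "A (x + y) = A x + A y" "A (x - y) = A x - A y" "A (c *\<^sub>C x) = c *\<^sub>C A x" "A 0 = 0"
proof -
  interpret A: bounded_linear A
    using assms by (simp add: selfadjoint_def bounded_clinear_def)
  show "A (x + y) = A x + A y" "A (x - y) = A x - A y" "A 0 = 0"
    by (rule A.add A.diff A.zero)+
  show "A (c *\<^sub>C x) = c *\<^sub>C A x"
    using assms by (simp add: selfadjoint_def bounded_clinear_def)
qed

lemma bounded_clinear_linear:
  assumes "bounded_clinear A"
  shows "A (x + y) = A x + A y" "A (c *\<^sub>C x) = c *\<^sub>C A x" "A 0 = 0"
proof -
  interpret A: bounded_linear A
    using assms by (simp add: bounded_clinear_def)
  show "A (x + y) = A x + A y" "A 0 = 0"
    by (rule A.add A.zero)+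
  show "A (c *\<^sub>C x) = c *\<^sub>C A x"
    using assms by (simp add: bounded_clinear_def)
qed

text \<open>Expanding \<open>norm (v - A (A v))\<close> squared, the mixed term is minus twice the
  square of \<open>norm (A v)\<close>; contractivity bounds the last term by one such square, so
  everything cancels.\<close>

lemma selfadjoint_contraction_norm_preserved_imp_fixed:
  assumes A: "selfadjoint A" "contraction A" and "norm (A v) = norm v"
  shows "A (A v) = v"
proof -
  have "inner v (A (A v)) = inner (A v) (A v)"
    using selfadjoint_cinner[OF A(1), of v "A v"] by (simp add: inner_eq_Re_cinner)
  then have "(norm (v - A (A v)))\<^sup>2 = (norm v)\<^sup>2 - 2 * (norm (A v))\<^sup>2 + (norm (A (A v)))\<^sup>2"
    unfolding power2_norm_eq_inner
    by (simp add: inner_diff_left inner_diff_right inner_commute)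
  moreover have "(norm (A (A v)))\<^sup>2 \<le> (norm (A v))\<^sup>2"
    using A(2) by (simp add: contraction_def power_mono)
  ultimately have "(norm (v - A (A v)))\<^sup>2 \<le> 0"
    using assms(3) by simp
  then show ?thesis by simp
qed

text \<open>The vectors orthogonal to \<open>q\<close> form a closed subspace containing
  \<open>S\<close>, hence everything, including \<open>q\<close> itself.\<close>

lemma orthogonal_dense_span_eq_0:
  fixes q :: "'a::complex_inner"
  assumes dense: "closure (module.span scaleC S) = UNIV" and "\<And>s. s \<in> S \<Longrightarrow> cinner s q = 0"
  shows "q = 0"
proof -
  interpret vs: vector_space "scaleC :: complex \<Rightarrow> 'a \<Rightarrow> 'a"
    by (rule vector_space_scaleC)
  have "vs.subspace {k. cinner k q = 0}"
    by (simp add: vs.subspace_def cinner_add_left cinner_scaleC_left)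
  with assms(2) have "vs.span S \<subseteq> {k. cinner k q = 0}"
    by (intro vs.span_minimal) auto
  then have "vs.span S \<subseteq> {k. inner k q = 0}"
    by (auto simp: inner_eq_Re_cinner)
  moreover have "closed {k. inner k q = 0}"
    by (intro closed_Collect_eq continuous_intros)
  ultimately have "closure (vs.span S) \<subseteq> {k. inner k q = 0}"
    by (rule closure_minimal)
  with dense have "inner q q = 0" by blast
  then show ?thesis by simp
qed

section \<open>The slit plane and the unit circle\<close>

lemma cis_in_slit_plane_iff: "cis t \<in> slit_plane \<longleftrightarrow> sin t \<noteq> 0"
proof -
  have "cis t = complex_of_real r \<longleftrightarrow> cos t = r \<and> sin t = 0" for r
    by (auto simp: complex_eq_iff)
  moreover have "sin t = 0 \<Longrightarrow> cos t \<le> -1 \<or> cos t \<ge> 1"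
    using sin_cos_squared_add[of t] by (simp add: power2_eq_1_iff) linarith
  ultimately show ?thesis
    unfolding slit_plane_def by (auto simp: image_iff)
qed

lemma cnj_in_slit_plane:
  assumes "z \<in> slit_plane"
  shows "cnj z \<in> slit_plane"
proof -
  have "cnj z = complex_of_real r \<Longrightarrow> z = complex_of_real r" for r
    by (metis complex_cnj_cnj complex_cnj_complex_of_real)
  with assms show ?thesis
    unfolding slit_plane_def by auto
qed

lemma AE_circle_sin_nonzero: "AE t in lebesgue_on {0..2*pi}. sin t \<noteq> 0"
proof -
  have "{t \<in> {0..2*pi}. sin t = 0} \<subseteq> {0, pi, 2*pi}"
  proof
    fix t :: real
    assume t: "t \<in> {t \<in> {0..2*pi}. sin t = 0}"
    have False if "t \<noteq> 0" "t \<noteq> pi" "t \<noteq> 2*pi"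
    proof (cases "t < pi")
      case True
      with t that show ?thesis using sin_gt_zero[of t] by simp
    next
      case False
      with t that show ?thesis using sin_lt_zero[of t] by simp
    qed
    then show "t \<in> {0, pi, 2*pi}" by blast
  qed
  then have "negligible {t \<in> {0..2*pi}. sin t = 0}"
    by (rule negligible_subset[rotated]) simp
  then have "AE t in lebesgue. t \<in> {0..2*pi} \<longrightarrow> sin t \<noteq> 0"
    by (intro AE_I'[of "{t \<in> {0..2*pi}. sin t = 0}"]) (auto simp: negligible_iff_null_sets)
  then show ?thesis
    by (simp add: AE_restrict_space_iff)
qed

text \<open>The interval has positive measure, so an almost-everywhere property cannot fail at every
  angle with nonzero sine. This extracts one nonreal point of isometry from an inner
  function.\<close>

lemma AE_circle_ex:
  assumes "AE t in lebesgue_on {0..2*pi}. P t"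
  shows "\<exists>t. sin t \<noteq> 0 \<and> P t"
proof (rule ccontr)
  assume "\<not> ?thesis"
  with AE_conjI[OF AE_circle_sin_nonzero assms] have "AE t in lebesgue_on {0..2*pi}. False"
    by (auto elim: eventually_mono)
  then have "emeasure (lebesgue_on {0..2*pi}) {0..2*pi} = 0"
    using ae_filter_eq_bot_iff[of "lebesgue_on {0..2*pi}"]
    by (simp add: eventually_False)
  then show False
    by (simp add: emeasure_restrict_space)
qed

section \<open>Block entries and resolvents of a passive selfadjoint system\<close>

locale passive_system =
  fixes D :: "'m::chilbert_space \<Rightarrow> 'm"
    and C :: "'k::chilbert_space \<Rightarrow> 'm"
    and F :: "'k \<Rightarrow> 'k"
  assumes system: "passive_selfadjoint_system D C F"
begin

abbreviation "T \<equiv> system_operator D C F"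
abbreviation "C' \<equiv> cadjoint C"

lemma selfadjoint: "selfadjoint D" "selfadjoint F" "selfadjoint T"
  and contraction_T: "contraction T"
  and C_clinear: "bounded_clinear C"
  using system by (auto simp: passive_selfadjoint_system_def)

lemmas contractions = passive_selfadjoint_system_contractions[OF system]
lemmas D_linear = selfadjoint_linear[OF selfadjoint(1)]
lemmas F_linear = selfadjoint_linear[OF selfadjoint(2)]
lemmas C_linear = bounded_clinear_linear[OF C_clinear]

lemma T_apply: "T (x, k) = (D x + C k, C' x + F k)"
  by (simp add: system_operator_def)

text \<open>Existence of the adjoint of \<open>C\<close> comes from the selfadjointness of \<open>T\<close>, not from
  the Riesz theorem.\<close>

lemma cinner_C: "cinner (C k) y = cinner k (C' y)"
  using selfadjoint_cinner[OF selfadjoint(3), of "(0, k)" "(y, 0)"]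
  by (simp add: T_apply cinner_prod_def D_linear F_linear)

lemma cinner_C': "cinner (C' y) k = cinner y (C k)"
  using cinner_C[of k y] by (metis cinner_commute)

lemma C'_linear: "C' (x + y) = C' x + C' y" "C' (c *\<^sub>C x) = c *\<^sub>C C' x" "C' 0 = 0"
proof -
  show "C' (x + y) = C' x + C' y"
    using selfadjoint_linear(1)[OF selfadjoint(3), of "(x, 0)" "(y, 0)"]
    by (simp add: T_apply F_linear)
  show "C' 0 = 0"
    using selfadjoint_linear(4)[OF selfadjoint(3)] by (simp add: zero_prod_def T_apply F_linear)
  show "C' (c *\<^sub>C x) = c *\<^sub>C C' x"
    using selfadjoint_linear(3)[OF selfadjoint(3), of c "(x, 0)"]
    by (simp add: T_apply scaleC_prod_def F_linear)
qed

lemma inv_resolvent_minus: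
  assumes "z \<in> slit_plane" "k - z *\<^sub>C F k = l"
  shows "inv (\<lambda>k. k - z *\<^sub>C F k) l = k"
  using bij_resolvent_minus[OF selfadjoint(2) contractions(2) assms(1)] assms(2)
  by (intro inv_f_eq) (auto simp: bij_def)

text \<open>Substituting \<open>x = y + z *\<^sub>C D y\<close> replaces reasoning about the inverse
  by polynomial identities in \<open>D\<close>.\<close>

lemma resolvent_plus_cases:
  assumes "z \<in> slit_plane"
  obtains y where "x = y + z *\<^sub>C D y" "inv (\<lambda>x. x + z *\<^sub>C D x) x = y"
  using bij_resolvent_plus[OF selfadjoint(1) contractions(1) assms]
  by (metis (no_types, lifting) bij_inv_eq_iff)

lemma system_identity:
  assumes z: "z \<in> slit_plane"
  obtains w where "w = C' x + z *\<^sub>C F w" "T (x, z *\<^sub>C w) = (transfer D C F z x, w)"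
proof -
  obtain w where w: "w - z *\<^sub>C F w = C' x"
    using surjD[OF bij_is_surj[OF bij_resolvent_minus[OF selfadjoint(2) contractions(2) z]], of "C' x"]
    by auto
  then have "inv (\<lambda>k. k - z *\<^sub>C F k) (C' x) = w"
    by (rule inv_resolvent_minus[OF z])
  then have "T (x, z *\<^sub>C w) = (transfer D C F z x, C' x + z *\<^sub>C F w)"
    by (simp add: T_apply transfer_def C_linear F_linear)
  moreover have "C' x + z *\<^sub>C F w = w"
    by (rule iffD1[OF diff_eq_eq w, symmetric])
  ultimately show ?thesis
    by (metis that)
qed

section \<open>Conservative systems have bi-inner transfer functions\<close>

lemma conservative_iff: "conservative D C F \<longleftrightarrow> (\<forall>v. T (T v) = v)"
  unfolding conservative_def by (rule selfadjoint_unitary_iff[OF selfadjoint(3)])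

lemma conservative_transfer:
  assumes "conservative D C F" "z \<in> slit_plane"
  shows "transfer D C F z (y + z *\<^sub>C D y) = z *\<^sub>C y + D y"
proof -
  interpret vm: vector_space "scaleC :: complex \<Rightarrow> 'm \<Rightarrow> 'm"
    by (rule vector_space_scaleC)
  interpret vk: vector_space "scaleC :: complex \<Rightarrow> 'k \<Rightarrow> 'k"
    by (rule vector_space_scaleC)
  \<comment> \<open>The first column of \<open>T\<^sup>2 = I\<close> holds both block
    identities.\<close>
  have "T (T (y, 0)) = (y, 0)"
    using assms(1) by (simp add: conservative_iff)
  then have DC: "D (D y) + C (C' y) = y" and FC: "C' (D y) + F (C' y) = 0"
    by (simp_all add: T_apply C_linear F_linear)
  from FC have "C' y - z *\<^sub>C F (C' y) = C' (y + z *\<^sub>C D y)"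
    by (simp add: C'_linear add_eq_0_iff)
  then have "inv (\<lambda>k. k - z *\<^sub>C F k) (C' (y + z *\<^sub>C D y)) = C' y"
    by (rule inv_resolvent_minus[OF assms(2)])
  then have "transfer D C F z (y + z *\<^sub>C D y) = D y + z *\<^sub>C (D (D y) + C (C' y))"
    by (simp add: transfer_def D_linear vm.scale_right_distrib)
  with DC show ?thesis by (simp add: add.commute)
qed

lemma conservative_isometric:
  assumes "conservative D C F" "z \<in> slit_plane" "cmod z = 1"
  shows "isometric (transfer D C F z)"
  unfolding isometric_def
proof
  fix x
  obtain y where y: "x = y + z *\<^sub>C D y"
    by (rule resolvent_plus_cases[OF assms(2)])
  have "cnj z * z = 1"
    using complex_norm_square[of z] assms(3) by (simp add: mult.commute)
  \<comment> \<open>Both sides have the same square terms as \<open>cmod z = 1\<close>; their cross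
    terms agree because \<open>cinner (D y) y = cinner y (D y)\<close>.\<close>
  then have "cinner (z *\<^sub>C y + D y) (z *\<^sub>C y + D y) = cinner (y + z *\<^sub>C D y) (y + z *\<^sub>C D y)"
    using selfadjoint_cinner[OF selfadjoint(1), of y y]
    by (simp add: cinner_add_left cinner_add_right cinner_scaleC_left cinner_scaleC_right
        distrib_left flip: mult.assoc)
  then have "(norm (z *\<^sub>C y + D y))\<^sup>2 = (norm (y + z *\<^sub>C D y))\<^sup>2"
    by (simp only: cinner_self of_real_eq_iff)
  then show "norm (transfer D C F z x) = norm x"
    unfolding y conservative_transfer[OF assms(1,2)] by simp
qed

text \<open>Reduces co-isometry at a point of the circle to isometry at its conjugate.\<close>

lemma conservative_cadjoint_transfer:
  assumes "conservative D C F" "z \<in> slit_plane"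
  shows "cadjoint (transfer D C F z) = transfer D C F (cnj z)"
proof (rule cadjoint_unique)
  fix x x'
  have z': "cnj z \<in> slit_plane"
    using assms(2) by (rule cnj_in_slit_plane)
  obtain y where y: "x = y + z *\<^sub>C D y"
    by (rule resolvent_plus_cases[OF assms(2)])
  obtain y' where y': "x' = y' + cnj z *\<^sub>C D y'"
    by (rule resolvent_plus_cases[OF z'])
  show "cinner (transfer D C F z x) x' = cinner x (transfer D C F (cnj z) x')"
    unfolding y y' conservative_transfer[OF assms] conservative_transfer[OF assms(1) z']
    using selfadjoint_cinner[OF selfadjoint(1)]
    by (simp add: cinner_add_left cinner_add_right cinner_scaleC_left cinner_scaleC_right
        distrib_left)
qed

lemma conservative_bi_inner:
  assumes "conservative D C F"
  shows "bi_inner_function (transfer D C F)"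
proof -
  have "isometric (transfer D C F (cis t)) \<and> co_isometric (transfer D C F (cis t))"
    if "sin t \<noteq> 0" for t
  proof -
    from that have t: "cis t \<in> slit_plane" by (simp add: cis_in_slit_plane_iff)
    then show ?thesis
      using conservative_isometric[OF assms t] cnj_in_slit_plane[OF t]
        conservative_isometric[OF assms, of "cnj (cis t)"]
      by (simp add: co_isometric_def conservative_cadjoint_transfer[OF assms t])
  qed
  then show ?thesis
    unfolding bi_inner_function_def inner_function_def co_inner_function_def
    by (auto intro: eventually_mono[OF AE_circle_sin_nonzero])
qed

section \<open>The defect range of \<open>T\<close> for an inner transfer function\<close>

lemma transfer_isometric_defect_orthogonal:
  assumes z: "z \<in> slit_plane" "cmod z = 1" and iso: "isometric (transfer D C F z)"
    and w: "w = C' x + z *\<^sub>C F w"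
    and pq: "(p, q) \<in> range (\<lambda>u. u - T (T u))"
  shows "cinner x p + z * cinner w q = 0"
proof -
  obtain u where u: "(p, q) = u - T (T u)" using pq by auto
  obtain w' where w': "w' = C' x + z *\<^sub>C F w'" "T (x, z *\<^sub>C w') = (transfer D C F z x, w')"
    by (rule system_identity[OF z(1)])
  have "w' = w"
    using inv_resolvent_minus[OF z(1), of w "C' x"] inv_resolvent_minus[OF z(1), of w' "C' x"]
      w w'(1) by (metis add_diff_cancel_right')
  define v where "v = (x, z *\<^sub>C w)"
  have "norm (T v) = norm v"
    using w'(2) iso z(2) by (simp add: v_def \<open>w' = w\<close> norm_Pair norm_scaleC isometric_def)
  then have "T (T v) = v"
    by (rule selfadjoint_contraction_norm_preserved_imp_fixed[OF selfadjoint(3) contraction_T])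
  \<comment> \<open>\<open>I - T\<^sup>2\<close> is selfadjoint and annihilates
    \<open>v\<close>.\<close>
  then have "cinner v (u - T (T u)) = 0"
    using selfadjoint_cinner[OF selfadjoint(3)] by (metis cinner_diff_right diff_self)
  then show ?thesis
    by (simp add: v_def cinner_prod_def cinner_scaleC_left flip: u)
qed

lemma T_defect_range: "v \<in> range (\<lambda>u. u - T (T u)) \<Longrightarrow> T v \<in> range (\<lambda>u. u - T (T u))"
  by (auto simp: selfadjoint_linear[OF selfadjoint(3)])

lemma transfer_isometric_defect_fst_eq_0:
  assumes z: "z \<in> slit_plane" "cmod z = 1" "Im z \<noteq> 0" and iso: "isometric (transfer D C F z)"
    and pq: "(p, q) \<in> range (\<lambda>u. u - T (T u))"
  shows "p = 0"
proof -
  obtain w where w: "w = C' p + z *\<^sub>C F w"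
    by (rule system_identity[OF z(1)])
  have zz: "cnj z * z = 1"
    using complex_norm_square[of z] z(2) by (simp add: mult.commute)
  have "cinner p p + z * cinner w q = 0"
    by (rule transfer_isometric_defect_orthogonal[OF z(1,2) iso w pq])
  then have "cnj z * cinner p p + (cnj z * z) * cinner w q = 0"
    by (metis distrib_left mult.assoc mult_zero_right)
  then have wq: "cinner w q = - cnj z * cinner p p"
    by (simp add: zz eq_neg_iff_add_eq_0 add.commute)
  \<comment> \<open>The same orthogonality, now against \<open>T (p, q)\<close>.\<close>
  have "cinner p (D p + C q) + z * cinner w (C' p + F q) = 0"
    using T_defect_range[OF pq]
    by (intro transfer_isometric_defect_orthogonal[OF z(1,2) iso w]) (simp add: T_apply)
  \<comment> \<open>Pairing the equation of \<open>w\<close> with \<open>q\<close> collects exactly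
    the terms in \<open>C q\<close> and \<open>F q\<close> above; the first orthogonality then
    expresses them through \<open>p\<close> alone.\<close>
  moreover have "cinner w q = cinner p (C q) + z * cinner w (F q)"
    using arg_cong[OF w, of "\<lambda>k. cinner k q"] selfadjoint_cinner[OF selfadjoint(2), of w q]
    by (simp add: cinner_add_left cinner_scaleC_left cinner_C')
  ultimately have "cinner p (D p) + z * cinner w (C' p) + cinner w q = 0"
    by (simp add: cinner_add_right algebra_simps)
  moreover have "z * cinner w (C' p) = z * cinner w w - cinner w (F w)"
  proof -
    have "z * cinner w w = z * cinner w (C' p) + (cnj z * z) * cinner w (F w)"
      using arg_cong[OF w, of "\<lambda>k. z * cinner w k"]
      by (simp add: cinner_add_right cinner_scaleC_right distrib_left mult_ac)
    then show ?thesis by (simp add: zz)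
  qed
  ultimately have "cinner p (D p) + (z * cinner w w - cinner w (F w)) - cnj z * cinner p p = 0"
    by (simp add: wq)
  then have "Im (cinner p (D p) + (z * cinner w w - cinner w (F w)) - cnj z * cinner p p) = 0"
    by simp
  \<comment> \<open>The forms of \<open>D\<close> and \<open>F\<close> are real, and
    \<open>- cnj z\<close> has the same imaginary part as \<open>z\<close>, so the two squares add
    up.\<close>
  then have "Im z * ((norm w)\<^sup>2 + (norm p)\<^sup>2) = 0"
    by (simp add: cinner_self selfadjoint_quadratic_form_real selfadjoint distrib_left)
  with z(3) show ?thesis
    by (simp add: add_nonneg_eq_0_iff)
qed

lemma minimal_inner_imp_conservative:
  assumes "minimal_system C F" "inner_function (transfer D C F)"
  shows "conservative D C F"
proof -
  obtain t where t: "sin t \<noteq> 0" and iso: "isometric (transfer D C F (cis t))"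
    using AE_circle_ex assms(2) unfolding inner_function_def by blast
  have fst0: "p = 0" if "(p, q) \<in> range (\<lambda>u. u - T (T u))" for p q
    by (rule transfer_isometric_defect_fst_eq_0[OF _ _ _ iso that])
      (use t in \<open>simp_all add: cis_in_slit_plane_iff\<close>)
  have q0: "q = 0" if q: "(0, q) \<in> range (\<lambda>u. u - T (T u))" for q
  proof -
    have step: "C k = 0" "(0, F k) \<in> range (\<lambda>u. u - T (T u))"
      if "(0, k) \<in> range (\<lambda>u. u - T (T u))" for k
    proof -
      have *: "(C k, F k) \<in> range (\<lambda>u. u - T (T u))"
        using T_defect_range[OF that] by (simp only: T_apply D_linear C'_linear add_0)
      then show "C k = 0" by (rule fst0)
      with * show "(0, F k) \<in> range (\<lambda>u. u - T (T u))" by (simp only:)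
    qed
    \<comment> \<open>Each power of \<open>F\<close> moves onto \<open>k\<close>, which changes at
      every step but stays in the second component of the defect range, where \<open>C\<close>
      vanishes.\<close>
    have "cinner ((F ^^ n) (C' x)) k = 0"
      if "(0, k) \<in> range (\<lambda>u. u - T (T u))" for n x k
      using that
    proof (induction n arbitrary: k)
      case 0
      then show ?case using step(1) by (simp add: cinner_C')
    next
      case (Suc n)
      then show ?case using step(2) by (simp add: selfadjoint_cinner[OF selfadjoint(2)])
    qed
    with q show ?thesis
      using assms(1) unfolding minimal_system_def
      by (intro orthogonal_dense_span_eq_0[of _ q]) auto
  qed
  have "T (T v) = v" for v
  proof -
    obtain p q where pq: "v - T (T v) = (p, q)" by fastforce
    then have r: "(p, q) \<in> range (\<lambda>u. u - T (T u))"
      by (intro image_eqI[of _ _ v]) simp_all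
    from fst0[OF r] r have "p = 0" "q = 0" using q0 by simp_all
    with pq show ?thesis by (simp flip: zero_prod_def)
  qed
  then show ?thesis by (simp add: conservative_iff)
qed

end

theorem proposition3p1:
  fixes D :: "'m::chilbert_space \<Rightarrow> 'm"
    and C :: "'k::chilbert_space \<Rightarrow> 'm"
    and F :: "'k \<Rightarrow> 'k"
  assumes "separable_space (euclidean :: 'm topology)"
    and "separable_space (euclidean :: 'k topology)"
    and "passive_selfadjoint_system D C F"
  shows "(conservative D C F \<longrightarrow>
           bi_inner_function (transfer D C F) \<and>
           (\<forall>z \<in> slit_plane.
              transfer D C F z = (\<lambda>x. z *\<^sub>C x + D x) \<circ> inv (\<lambda>x. x + z *\<^sub>C D x)))
       \<and> (minimal_system C F \<and> inner_function (transfer D C F) \<longrightarrow> conservative D C F)"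
proof -
  interpret passive_system D C F
    by unfold_locales (rule assms(3))
  have "transfer D C F z x = ((\<lambda>x. z *\<^sub>C x + D x) \<circ> inv (\<lambda>x. x + z *\<^sub>C D x)) x"
    if cons: "conservative D C F" and z: "z \<in> slit_plane" for z x
  proof -
    obtain y where y: "x = y + z *\<^sub>C D y" "inv (\<lambda>x. x + z *\<^sub>C D x) x = y"
      by (rule resolvent_plus_cases[OF z])
    with conservative_transfer[OF cons z, of y] show ?thesis by simp
  qed
  then show ?thesis
    using conservative_bi_inner minimal_inner_imp_conservative by blast
qed

end
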